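(* Let $r$ be an even integer and let $n$ be a positive integer. Then \[ F_{3r}\sum_{k=1}^n F_{2rk}^3 = F_{rn}^2F_{rn+r}^2\left(L_{rn}L_{rn+r}+L_r\right). \]
   Context: The Fibonacci numbers $F_m$ and Lucas numbers $L_m$ are defined for all $m\in\mathbb{Z}$ by $F_m=F_{m-1}+F_{m-2}$, $F_0=0$, $F_1=1$, and $L_m=L_{m-1}+L_{m-2}$, $L_0=2$, $L_1=1$; in particular $F_{-m}=(-1)^{m-1}F_m$ and $L_{-m}=(-1)^mL_m$. *)

theory Defs
  imports "HOL-Number_Theory.Fib"
begin

text \<open>
  The library function \<open>fib\<close> is only defined on \<open>nat\<close>. Both sequences below are defined on all
  integers; for negative indices the recurrence is read backwards, as
  \<open>F m = F (m + 2) - F (m + 1)\<close>.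
\<close>

function fib_int :: "int \<Rightarrow> int" where
  "fib_int m =
    (if m = 0 then 0
     else if m = 1 then 1
     else if m > 1 then fib_int (m - 1) + fib_int (m - 2)
     else fib_int (m + 2) - fib_int (m + 1))"
  by auto
termination
  by (relation "measure (\<lambda>m. nat (if m < 0 then 1 - m else m))") auto

function lucas_int :: "int \<Rightarrow> int" where
  "lucas_int m =
    (if m = 0 then 2
     else if m = 1 then 1
     else if m > 1 then lucas_int (m - 1) + lucas_int (m - 2)
     else lucas_int (m + 2) - lucas_int (m + 1))"
  by auto
termination
  by (relation "measure (\<lambda>m. nat (if m < 0 then 1 - m else m))") auto

declare fib_int.simps [simp del] lucas_int.simps [simp del]

lemma fib_int_0 [simp]: "fib_int 0 = 0"
  and fib_int_1 [simp]: "fib_int 1 = 1"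
  by (simp_all add: fib_int.simps)

lemma lucas_int_0 [simp]: "lucas_int 0 = 2"
  and lucas_int_1 [simp]: "lucas_int 1 = 1"
  by (simp_all add: lucas_int.simps)

lemma fib_int_rec: "fib_int m = fib_int (m - 1) + fib_int (m - 2)"
proof (cases "m > 1")
  case True
  then show ?thesis by (simp add: fib_int.simps[of m])
next
  case False
  then show ?thesis by (simp add: fib_int.simps[of "m - 2"])
qed

lemma lucas_int_rec: "lucas_int m = lucas_int (m - 1) + lucas_int (m - 2)"
proof (cases "m > 1")
  case True
  then show ?thesis by (simp add: lucas_int.simps[of m])
next
  case False
  then show ?thesis by (simp add: lucas_int.simps[of "m - 2"])
qed

lemma fib_int_of_nat: "fib_int (int n) = int (fib n)"
proof (induction n rule: fib.induct)
  case (3 n)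
  then show ?case
    using fib_int_rec[of "int (Suc (Suc n))"] by (simp add: algebra_simps)
qed simp_all

end

theory Submission
  imports Defs
begin

text \<open>
  The right-hand side vanishes for \<open>n = 0\<close>, so it suffices that it telescopes: with \<open>a = r * n\<close>
  the difference of its values at \<open>n\<close> and \<open>n - 1\<close> has to be \<open>F(3r) * F(2a)^3\<close>. The addition
  formulas \<open>2 F(m + n) = F(m) L(n) + L(m) F(n)\<close> and \<open>2 L(m + n) = L(m) L(n) + 5 F(m) F(n)\<close>
  (lemmas \<open>fib_int_add\<close> and \<open>lucas_int_add\<close>) express every term through \<open>F(a)\<close>, \<open>L(a)\<close>, \<open>F(r)\<close>
  and \<open>L(r)\<close>. Since \<open>r\<close> is even, so is \<open>a\<close>, and \<open>L(m)^2 - 5 F(m)^2 = 4\<close> holds for even \<open>m\<close>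
  (\<open>lucas_sq_even\<close>). Modulo this relation for \<open>m = a\<close> and \<open>m = r\<close> the telescoping step is an
  identity of polynomials.
\<close>

text \<open>
  A sequence satisfying the recurrence is determined, in both directions, by two adjacent values.
  This turns every linear identity between such sequences into two checks.
\<close>

lemma fib_recurrence_unique:
  fixes f g :: "int \<Rightarrow> int"
  assumes f: "\<And>m. f m = f (m - 1) + f (m - 2)"
    and g: "\<And>m. g m = g (m - 1) + g (m - 2)"
    and "f 0 = g 0" and "f 1 = g 1"
  shows "f m = g m"
proof -
  have "f m = g m \<and> f (m + 1) = g (m + 1)"
  proof (induction m rule: int_induct[where k = 0])
    case base
    then show ?case using assms(3,4) by simp
  next
    case (step1 i)
    then show ?case using f[of "i + 2"] g[of "i + 2"] by (simp add: algebra_simps)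
  next
    case (step2 i)
    then show ?case using f[of "i + 1"] g[of "i + 1"] by (simp add: algebra_simps)
  qed
  then show ?thesis ..
qed

lemma fib_int_Suc: "2 * fib_int (m + 1) = fib_int m + lucas_int m"
proof (rule fib_recurrence_unique[where m = m])
  fix m
  show "2 * fib_int (m + 1) = 2 * fib_int (m - 1 + 1) + 2 * fib_int (m - 2 + 1)"
    using fib_int_rec[of "m + 1"] by (simp add: algebra_simps)
  show "fib_int m + lucas_int m =
      fib_int (m - 1) + lucas_int (m - 1) + (fib_int (m - 2) + lucas_int (m - 2))"
    using fib_int_rec[of m] lucas_int_rec[of m] by simp
next
  show "2 * fib_int (1 + 1) = fib_int 1 + lucas_int 1"
    using fib_int_rec[of 2] by simp
qed simp

lemma lucas_int_Suc: "2 * lucas_int (m + 1) = lucas_int m + 5 * fib_int m"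
proof (rule fib_recurrence_unique[where m = m])
  fix m
  show "2 * lucas_int (m + 1) = 2 * lucas_int (m - 1 + 1) + 2 * lucas_int (m - 2 + 1)"
    using lucas_int_rec[of "m + 1"] by (simp add: algebra_simps)
  show "lucas_int m + 5 * fib_int m =
      lucas_int (m - 1) + 5 * fib_int (m - 1) + (lucas_int (m - 2) + 5 * fib_int (m - 2))"
    using fib_int_rec[of m] lucas_int_rec[of m] by simp
next
  show "2 * lucas_int (1 + 1) = lucas_int 1 + 5 * fib_int 1"
    using lucas_int_rec[of 2] by simp
qed simp

lemma fib_int_add:
  "2 * fib_int (m + n) = fib_int m * lucas_int n + lucas_int m * fib_int n"
proof (rule fib_recurrence_unique[where m = n])
  fix n
  show "2 * fib_int (m + n) = 2 * fib_int (m + (n - 1)) + 2 * fib_int (m + (n - 2))"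
    using fib_int_rec[of "m + n"] by (simp add: algebra_simps)
  show "fib_int m * lucas_int n + lucas_int m * fib_int n =
      fib_int m * lucas_int (n - 1) + lucas_int m * fib_int (n - 1) +
      (fib_int m * lucas_int (n - 2) + lucas_int m * fib_int (n - 2))"
    by (simp add: fib_int_rec[of n] lucas_int_rec[of n] algebra_simps)
next
  show "2 * fib_int (m + 1) = fib_int m * lucas_int 1 + lucas_int m * fib_int 1"
    using fib_int_Suc[of m] by simp
qed simp

lemma lucas_int_add:
  "2 * lucas_int (m + n) = lucas_int m * lucas_int n + 5 * fib_int m * fib_int n"
proof (rule fib_recurrence_unique[where m = n])
  fix n
  show "2 * lucas_int (m + n) = 2 * lucas_int (m + (n - 1)) + 2 * lucas_int (m + (n - 2))"
    using lucas_int_rec[of "m + n"] by (simp add: algebra_simps)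
  show "lucas_int m * lucas_int n + 5 * fib_int m * fib_int n =
      lucas_int m * lucas_int (n - 1) + 5 * fib_int m * fib_int (n - 1) +
      (lucas_int m * lucas_int (n - 2) + 5 * fib_int m * fib_int (n - 2))"
    by (simp add: fib_int_rec[of n] lucas_int_rec[of n] algebra_simps)
next
  show "2 * lucas_int (m + 1) = lucas_int m * lucas_int 1 + 5 * fib_int m * fib_int 1"
    using lucas_int_Suc[of m] by simp
qed simp

text \<open>
  The form \<open>L^2 - 5 F^2\<close> is the norm of \<open>L + F sqrt 5\<close>, and stepping the index multiplies this
  number by the golden ratio, whose norm is \<open>-1\<close>.
\<close>

lemma lucas_fib_norm_Suc:
  "lucas_int (m + 1) ^ 2 - 5 * fib_int (m + 1) ^ 2 = - (lucas_int m ^ 2 - 5 * fib_int m ^ 2)"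
  using fib_int_Suc[of m] lucas_int_Suc[of m] by algebra

lemma lucas_sq_even:
  assumes "even m"
  shows "lucas_int m ^ 2 = 5 * fib_int m ^ 2 + 4"
proof -
  obtain i where m: "m = 2 * i" using assms by blast
  have "lucas_int (2 * i) ^ 2 - 5 * fib_int (2 * i) ^ 2 = 4"
  proof (induction i rule: int_induct[where k = 0])
    case (step1 i)
    then show ?case
      using lucas_fib_norm_Suc[of "2 * i"] lucas_fib_norm_Suc[of "2 * i + 1"]
      by (simp add: algebra_simps)
  next
    case (step2 i)
    then show ?case
      using lucas_fib_norm_Suc[of "2 * i - 2"] lucas_fib_norm_Suc[of "2 * i - 1"]
      by (simp add: algebra_simps)
  qed simp
  then show ?thesis using m by simp
qed

text \<open>
  Reflection follows from the addition formulas for \<open>m + (- m) = 0\<close>, which form a linear system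
  for \<open>F(-m)\<close> and \<open>L(-m)\<close> with determinant \<open>L(m)^2 - 5 F(m)^2 = 4\<close>.
\<close>

lemma
  assumes "even m"
  shows fib_int_minus_even: "fib_int (- m) = - fib_int m"
    and lucas_int_minus_even: "lucas_int (- m) = lucas_int m"
proof -
  have F: "fib_int m * lucas_int (- m) + lucas_int m * fib_int (- m) = 0"
    using fib_int_add[of m "- m"] by simp
  have L: "lucas_int m * lucas_int (- m) + 5 * fib_int m * fib_int (- m) = 4"
    using lucas_int_add[of m "- m"] by simp
  have "4 * fib_int (- m) = 4 * (- fib_int m)"
    using F L lucas_sq_even[OF assms] by algebra
  then show "fib_int (- m) = - fib_int m" by simp
  have "4 * lucas_int (- m) = 4 * lucas_int m"
    using F L lucas_sq_even[OF assms] by algebra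
  then show "lucas_int (- m) = lucas_int m" by simp
qed

lemma fib_int_double: "fib_int (2 * m) = fib_int m * lucas_int m"
  using fib_int_add[of m m] by (simp add: algebra_simps)

lemma fib_int_triple_even:
  assumes "even m"
  shows "fib_int (3 * m) = fib_int m * (lucas_int m ^ 2 - 1)"
proof -
  have "2 * fib_int (3 * m) = fib_int (2 * m) * lucas_int m + lucas_int (2 * m) * fib_int m"
    using fib_int_add[of "2 * m" m] by simp
  moreover have "2 * lucas_int (2 * m) = lucas_int m ^ 2 + 5 * fib_int m ^ 2"
    using lucas_int_add[of m m] by (simp add: power2_eq_square)
  ultimately have "4 * fib_int (3 * m) = 4 * (fib_int m * (lucas_int m ^ 2 - 1))"
    using fib_int_double[of m] lucas_sq_even[OF assms] by algebra
  then show ?thesis by simp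
qed

text \<open>
  After division by \<open>F(a)^2\<close> the right-hand side depends on \<open>P = F(a + r)\<close> and \<open>M = F(a - r)\<close>
  only through \<open>P^2 - M^2\<close> and \<open>P^2 + M^2\<close>: by the addition formula the factors \<open>L(a + r)\<close>
  and \<open>L(a - r)\<close> are the sum and the difference of \<open>L(a) L(r) / 2\<close> and \<open>5 F(a) F(r) / 2\<close>.
  The same formula for \<open>P\<close> and \<open>M\<close> makes \<open>P^2 - M^2\<close> a monomial and cancels the cross terms
  in \<open>P^2 + M^2\<close>. All that remains is to eliminate \<open>F(a)^2\<close> and \<open>F(r)^2\<close> in favour of
  \<open>L(a)^2\<close> and \<open>L(r)^2\<close>.
\<close>

lemma fib_lucas_telescope:
  assumes a: "even a" and r: "even r"
  shows "fib_int (3 * r) * fib_int (2 * a) ^ 3 =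
    fib_int a ^ 2 * fib_int (a + r) ^ 2 * (lucas_int a * lucas_int (a + r) + lucas_int r) -
    fib_int (a - r) ^ 2 * fib_int a ^ 2 * (lucas_int (a - r) * lucas_int a + lucas_int r)"
proof -
  define u v s t where "u = fib_int a" and "v = lucas_int a"
    and "s = fib_int r" and "t = lucas_int r"
  define P M K N where "P = fib_int (a + r)" and "M = fib_int (a - r)"
    and "K = lucas_int (a + r)" and "N = lucas_int (a - r)"
  note defs = u_def v_def s_def t_def P_def M_def K_def N_def
  have P: "2 * P = u * t + v * s" and K: "2 * K = v * t + 5 * u * s"
    unfolding defs by (rule fib_int_add lucas_int_add)+
  have M: "2 * M = u * t - v * s" and N: "2 * N = v * t - 5 * u * s"
    using fib_int_add[of a "- r"] lucas_int_add[of a "- r"]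
    unfolding defs by (simp_all add: fib_int_minus_even lucas_int_minus_even r)
  have v: "v ^ 2 = 5 * u ^ 2 + 4" and t: "t ^ 2 = 5 * s ^ 2 + 4"
    using lucas_sq_even a r unfolding defs by auto
  have diff: "P ^ 2 - M ^ 2 = u * v * s * t"
  proof -
    have "4 * (P ^ 2 - M ^ 2) = 4 * (u * v * s * t)" using P M by algebra
    then show ?thesis by simp
  qed
  have sum: "2 * (P ^ 2 + M ^ 2) = u ^ 2 * t ^ 2 + v ^ 2 * s ^ 2"
  proof -
    have "4 * (P ^ 2 + M ^ 2) = 2 * (u ^ 2 * t ^ 2 + v ^ 2 * s ^ 2)" using P M by algebra
    then show ?thesis by simp
  qed
  have "2 * (P ^ 2 * K - M ^ 2 * N) = v * t * (P ^ 2 - M ^ 2) + 5 * u * s * (P ^ 2 + M ^ 2)"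
    using K N by algebra
  then have "4 * (P ^ 2 * K - M ^ 2 * N) =
      2 * v * t * (u * v * s * t) + 5 * u * s * (u ^ 2 * t ^ 2 + v ^ 2 * s ^ 2)"
    using diff sum by algebra
  also have "\<dots> = 4 * (u * s * (v ^ 2 * (t ^ 2 - 1) - t ^ 2))"
    using v t by algebra
  finally have "P ^ 2 * K - M ^ 2 * N = u * s * (v ^ 2 * (t ^ 2 - 1) - t ^ 2)" by simp
  then have "s * (t ^ 2 - 1) * (u * v) ^ 3 =
      u ^ 2 * P ^ 2 * (v * K + t) - M ^ 2 * u ^ 2 * (N * v + t)"
    using diff by algebra
  then show ?thesis
    unfolding fib_int_triple_even[OF r] fib_int_double defs .
qed

theorem theorem3p4:
  fixes r :: int and n :: nat
  assumes "even r" and "n > 0"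
  shows "fib_int (3 * r) * (\<Sum>k = 1..n. fib_int (2 * r * int k) ^ 3) =
    fib_int (r * int n) ^ 2 * fib_int (r * int n + r) ^ 2 *
    (lucas_int (r * int n) * lucas_int (r * int n + r) + lucas_int r)"
proof -
  \<comment> \<open>The induction starts at the empty sum, where the factor \<open>F(0)\<close> makes the right-hand side zero.\<close>
  have "fib_int (3 * r) * (\<Sum>k = 1..n. fib_int (2 * r * int k) ^ 3) =
    fib_int (r * int n) ^ 2 * fib_int (r * int n + r) ^ 2 *
    (lucas_int (r * int n) * lucas_int (r * int n + r) + lucas_int r)" for n
  proof (induction n)
    case 0
    then show ?case by simp
  next
    case (Suc n)
    have a: "r * int (Suc n) = r * int n + r" by (simp add: algebra_simps)
    have "fib_int (3 * r) * (\<Sum>k = 1..Suc n. fib_int (2 * r * int k) ^ 3) =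
        fib_int (3 * r) * (\<Sum>k = 1..n. fib_int (2 * r * int k) ^ 3) +
        fib_int (3 * r) * fib_int (2 * (r * int n + r)) ^ 3"
      by (simp add: distrib_left algebra_simps)
    then show ?case
      unfolding Suc.IH a
      using fib_lucas_telescope[of "r * int n + r" r] \<open>even r\<close> by simp
  qed
  then show ?thesis .
qed

end
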